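(* Let $(K,v)$ be a valued field with value group $\Gamma_v$, let $\Lambda$ be a totally ordered abelian group containing the divisible hull $\Gamma_{\mathbb{Q}}=\Gamma_v\otimes_{\mathbb{Z}}\mathbb{Q}$, and let $\mathfrak{v}=\{\nu_i\}_{i\in I}\subset\mathcal{T}=\mathcal{T}(v,\Lambda)$ be an increasing family of valuations admitting a supremum $\sup_{i\in I}\nu_i$ in $\mathcal{T}$. Then $\lim_{i\in I}\nu_i\to\sup_{i\in I}\nu_i$ when $\mathcal{T}$ is considered with the Scott topology (of $(\mathcal{T},\leq)$); that is, $\sup_{i\in I}\nu_i$ is a limit of $\{\nu_i\}_{i\in I}$ in this topology.
   Context: A valuation on $K[x]$ is a map $\nu:K[x]\to\Lambda_\infty=\Lambda\cup\{\infty\}$ with $\nu(fg)=\nu(f)+\nu(g)$, $\nu(f+g)\geq\min\{\nu(f),\nu(g)\}$, $\nu(1)=0$, $\nu(0)=\infty$ (nonzero polynomials may have value $\infty$). $\mathcal{T}(v,\Lambda)$ is the set of valuations $\nu:K[x]\to\Lambda_\infty$ with $\nu|_K=v$, partially ordered by $\mu\leq\nu$ iff $\mu(f)\leq\nu(f)$ for all $f\in K[x]$. Known facts: each $(-\infty,\mu]=\{\nu\in\mathcal{T}\mid\nu\leq\mu\}$ is totally ordered, and any $\mu,\nu\in\mathcal{T}$ have an infimum $\mu\wedge\nu\in\mathcal{T}$. An increasing family of valuations is a (non-empty) totally ordered subset $\{\nu_i\}_{i\in I}$ of $\mathcal{T}$ without maximum; the index set $I$ is totally ordered so that $i<j$ iff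 $\nu_i<\nu_j$. A supremum of it is an element $\mu\in\mathcal{T}$ with $\nu_i\leq\mu$ for all $i\in I$ and such that any $\mu'\in\mathcal{T}$ with $\nu_i\leq\mu'$ for all $i\in I$ and $\mu'\leq\mu$ equals $\mu$; such an element is unique if it exists, and is denoted $\sup_{i\in I}\nu_i$. A point $y$ of a topological space $Y$ is a limit of a family $\{y_i\}_{i\in I}$ indexed by a directed set $I$ if for every open neighbourhood $U$ of $y$ there is $i_0\in I$ with $y_j\in U$ for all $j\geq i_0$; this is written $\lim_{i\in I}y_i\to y$. Scott topology of a partially ordered set $(P,\leq)$: a directed set is a non-empty $D\subseteq P$ in which every pair of elements has an upper bound in $D$. $O\subseteq P$ is Scott open if it is an upper set, and for every directed set $D\subseteq P$ having a supremum (least upper bound) lying in $O$ one has $D\cap O\neq\emptyset$. The Scott topology is the set of all Scott open sets. *)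

theory Defs
  imports
    "HOL-Analysis.Abstract_Topology"
    "HOL-Library.Extended_Nat"
    "HOL-Computational_Algebra.Polynomial"
begin

datatype 'g with_inf = Fin 'g | Infty

instantiation with_inf :: (type) infinity
begin
definition infinity_with_inf :: "'a with_inf" where "\<infinity> = Infty"
instance ..
end

instantiation with_inf :: (linorder) linorder
begin

fun less_eq_with_inf :: "'a with_inf \<Rightarrow> 'a with_inf \<Rightarrow> bool" where
  "less_eq_with_inf x Infty = True"
| "less_eq_with_inf Infty (Fin b) = False"
| "less_eq_with_inf (Fin a) (Fin b) = (a \<le> b)"

definition less_with_inf :: "'a with_inf \<Rightarrow> 'a with_inf \<Rightarrow> bool" where
  "less_with_inf x y \<longleftrightarrow> x \<le> y \<and> \<not> y \<le> x"

instance
proof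
  fix x y z :: "'a with_inf"
  show "x < y \<longleftrightarrow> x \<le> y \<and> \<not> y \<le> x" by (rule less_with_inf_def)
  show "x \<le> x" by (cases x) auto
  show "x \<le> y \<Longrightarrow> y \<le> z \<Longrightarrow> x \<le> z" by (cases x; cases y; cases z) auto
  show "x \<le> y \<Longrightarrow> y \<le> x \<Longrightarrow> x = y" by (cases x; cases y) auto
  show "x \<le> y \<or> y \<le> x" by (cases x; cases y) auto
qed

end

instantiation with_inf :: (comm_monoid_add) comm_monoid_add
begin

definition zero_with_inf :: "'a with_inf" where "0 = Fin 0"

fun plus_with_inf :: "'a with_inf \<Rightarrow> 'a with_inf \<Rightarrow> 'a with_inf" where
  "plus_with_inf (Fin a) (Fin b) = Fin (a + b)"
| "plus_with_inf Infty y = Infty"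
| "plus_with_inf (Fin a) Infty = Infty"

instance
proof
  fix x y z :: "'a with_inf"
  show "x + y + z = x + (y + z)" by (cases x; cases y; cases z) (auto simp: add.assoc)
  show "x + y = y + x" by (cases x; cases y) (auto simp: add.commute)
  show "0 + x = x" by (cases x) (auto simp: zero_with_inf_def)
qed

end

text \<open>Nonzero elements may take the value \<open>\<infinity>\<close>.\<close>

definition valuation :: "('r::comm_ring_1 \<Rightarrow> 'g::linordered_ab_group_add with_inf) \<Rightarrow> bool" where
  "valuation \<nu> \<longleftrightarrow>
     (\<forall>f g. \<nu> (f * g) = \<nu> f + \<nu> g) \<and>
     (\<forall>f g. \<nu> (f + g) \<ge> min (\<nu> f) (\<nu> g)) \<and>
     \<nu> 1 = 0 \<and> \<nu> 0 = \<infinity>"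

definition valued_field :: "('k::field \<Rightarrow> 'g::linordered_ab_group_add with_inf) \<Rightarrow> bool" where
  "valued_field v \<longleftrightarrow> valuation v \<and> (\<forall>a. v a = \<infinity> \<longleftrightarrow> a = 0)"

definition value_group :: "('k::field \<Rightarrow> 'g::linordered_ab_group_add with_inf) \<Rightarrow> 'g set" where
  "value_group v = {\<gamma>. \<exists>a. a \<noteq> 0 \<and> v a = Fin \<gamma>}"

definition nat_mult :: "nat \<Rightarrow> 'g::ab_group_add \<Rightarrow> 'g" where
  "nat_mult n g = (\<Sum>i<n. g)"

text \<open>\<open>D\<close> is a divisible hull of the subgroup \<open>G\<close>: a divisible group containing \<open>G\<close> with \<open>D/G\<close>
  torsion. Since an ordered group is torsion-free, such a \<open>D\<close> is a copy of \<open>G \<otimes> \<rat>\<close>, the element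
  \<open>g \<otimes> m/n\<close> being the unique \<open>d\<close> with \<open>n d = m g\<close>, and its order is the only one extending that
  of \<open>G\<close>.\<close>

definition is_divisible_hull ::
    "'g::linordered_ab_group_add set \<Rightarrow> 'g set \<Rightarrow> bool" where
  "is_divisible_hull G D \<longleftrightarrow>
     G \<subseteq> D \<and> 0 \<in> D \<and> (\<forall>a\<in>D. \<forall>b\<in>D. a - b \<in> D) \<and>
     (\<forall>d\<in>D. \<forall>n>0. \<exists>e\<in>D. nat_mult n e = d) \<and>
     (\<forall>d\<in>D. \<exists>n>0. nat_mult n d \<in> G)"

text \<open>The set \<open>\<T>(v, \<Lambda>)\<close>, where \<open>\<Lambda>\<close> is the type \<open>'g\<close>. Its partial order is the pointwise order of
  the function type.\<close>

definition valuations_over ::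
    "('k::field \<Rightarrow> 'g::linordered_ab_group_add with_inf) \<Rightarrow> ('k poly \<Rightarrow> 'g with_inf) set" where
  "valuations_over v = {\<nu>. valuation \<nu> \<and> (\<forall>a. \<nu> [:a:] = v a)}"

text \<open>The index type is only partially ordered, so that \<open>'i\<close> may be the type of valuations itself,
  with \<open>\<nu>\<close> the identity; the index set \<open>I\<close> is totally ordered.\<close>

definition increasing_family ::
    "('k::field \<Rightarrow> 'g::linordered_ab_group_add with_inf) \<Rightarrow> 'i::order set \<Rightarrow>
     ('i \<Rightarrow> 'k poly \<Rightarrow> 'g with_inf) \<Rightarrow> bool" where
  "increasing_family v I \<nu> \<longleftrightarrow>
     I \<noteq> {} \<and> \<nu> ` I \<subseteq> valuations_over v \<and>
     Complete_Partial_Order.chain (\<le>) (\<nu> ` I) \<and>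
     \<not> (\<exists>m\<in>\<nu> ` I. \<forall>\<mu>\<in>\<nu> ` I. \<mu> \<le> m) \<and>
     Complete_Partial_Order.chain (\<le>) I \<and>
     (\<forall>i\<in>I. \<forall>j\<in>I. i < j \<longleftrightarrow> \<nu> i < \<nu> j)"

text \<open>A minimal upper bound in \<open>\<T>(v, \<Lambda>)\<close>; being the least upper bound is not part of the
  definition.\<close>

definition is_family_sup ::
    "('k::field \<Rightarrow> 'g::linordered_ab_group_add with_inf) \<Rightarrow> 'i set \<Rightarrow>
     ('i \<Rightarrow> 'k poly \<Rightarrow> 'g with_inf) \<Rightarrow> ('k poly \<Rightarrow> 'g with_inf) \<Rightarrow> bool" where
  "is_family_sup v I \<nu> \<mu> \<longleftrightarrow>
     \<mu> \<in> valuations_over v \<and> (\<forall>i\<in>I. \<nu> i \<le> \<mu>) \<and>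
     (\<forall>\<mu>'\<in>valuations_over v. (\<forall>i\<in>I. \<nu> i \<le> \<mu>') \<and> \<mu>' \<le> \<mu> \<longrightarrow> \<mu>' = \<mu>)"

definition directed_subset :: "'a::order set \<Rightarrow> 'a set \<Rightarrow> bool" where
  "directed_subset P D \<longleftrightarrow> D \<noteq> {} \<and> D \<subseteq> P \<and> (\<forall>a\<in>D. \<forall>b\<in>D. \<exists>c\<in>D. a \<le> c \<and> b \<le> c)"

definition is_lub_in :: "'a::order set \<Rightarrow> 'a set \<Rightarrow> 'a \<Rightarrow> bool" where
  "is_lub_in P D s \<longleftrightarrow> s \<in> P \<and> (\<forall>d\<in>D. d \<le> s) \<and> (\<forall>u\<in>P. (\<forall>d\<in>D. d \<le> u) \<longrightarrow> s \<le> u)"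

definition scott_open :: "'a::order set \<Rightarrow> 'a set \<Rightarrow> bool" where
  "scott_open P U \<longleftrightarrow>
     U \<subseteq> P \<and> (\<forall>a\<in>U. \<forall>b\<in>P. a \<le> b \<longrightarrow> b \<in> U) \<and>
     (\<forall>D s. directed_subset P D \<and> is_lub_in P D s \<and> s \<in> U \<longrightarrow> D \<inter> U \<noteq> {})"

definition scott_topology :: "'a::order set \<Rightarrow> 'a topology" where
  "scott_topology P = topology (scott_open P)"

lemma istopology_scott_open: "istopology (scott_open P)"
  unfolding istopology_def
proof (intro conjI allI impI)
  fix S T assume S: "scott_open P S" and T: "scott_open P T"
  have "D \<inter> (S \<inter> T) \<noteq> {}"
    if D: "directed_subset P D" and s: "is_lub_in P D s" "s \<in> S \<inter> T" for D s
  proof -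
    have "D \<inter> S \<noteq> {}" "D \<inter> T \<noteq> {}"
      using S T D s unfolding scott_open_def by auto
    then obtain a b where ab: "a \<in> D" "a \<in> S" "b \<in> D" "b \<in> T"
      by auto
    obtain c where c: "c \<in> D" "a \<le> c" "b \<le> c"
      using D ab(1,3) unfolding directed_subset_def by metis
    have "c \<in> P"
      using D c(1) unfolding directed_subset_def by auto
    then have "c \<in> S" "c \<in> T"
      using S T ab c unfolding scott_open_def by metis+
    with c(1) show ?thesis by auto
  qed
  moreover have "S \<inter> T \<subseteq> P" "\<forall>a\<in>S \<inter> T. \<forall>b\<in>P. a \<le> b \<longrightarrow> b \<in> S \<inter> T"
    using S T unfolding scott_open_def by auto
  ultimately show "scott_open P (S \<inter> T)"
    unfolding scott_open_def by metis
next
  fix \<K> assume K: "\<forall>K\<in>\<K>. scott_open P K"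
  have "D \<inter> \<Union>\<K> \<noteq> {}"
    if D: "directed_subset P D" "is_lub_in P D s" "s \<in> \<Union>\<K>" for D s
  proof -
    obtain K where "K \<in> \<K>" "s \<in> K" using D(3) by auto
    then have "D \<inter> K \<noteq> {}" using K D(1,2) unfolding scott_open_def by metis
    with \<open>K \<in> \<K>\<close> show ?thesis by auto
  qed
  moreover have "\<Union>\<K> \<subseteq> P" "\<forall>a\<in>\<Union>\<K>. \<forall>b\<in>P. a \<le> b \<longrightarrow> b \<in> \<Union>\<K>"
    using K unfolding scott_open_def by (blast, meson Union_iff)
  ultimately show "scott_open P (\<Union>\<K>)"
    unfolding scott_open_def by metis
qed

lemma openin_scott_topology [simp]: "openin (scott_topology P) U \<longleftrightarrow> scott_open P U"
  by (simp add: scott_topology_def istopology_scott_open topology_inverse')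

lemma topspace_scott_topology [simp]: "topspace (scott_topology P) = P"
proof -
  have "D \<inter> P \<noteq> {}" if "directed_subset P D" for D
    using that unfolding directed_subset_def by auto
  then have "scott_open P P"
    unfolding scott_open_def by simp
  moreover have "U \<subseteq> P" if "scott_open P U" for U
    using that unfolding scott_open_def by simp
  ultimately show ?thesis
    unfolding topspace_def openin_scott_topology by blast
qed

definition is_net_limit :: "'a topology \<Rightarrow> 'i::order set \<Rightarrow> ('i \<Rightarrow> 'a) \<Rightarrow> 'a \<Rightarrow> bool" where
  "is_net_limit Y I y l \<longleftrightarrow>
     l \<in> topspace Y \<and> y ` I \<subseteq> topspace Y \<and>
     (\<forall>U. openin Y U \<and> l \<in> U \<longrightarrow> (\<exists>i\<^sub>0\<in>I. \<forall>j\<in>I. i\<^sub>0 \<le> j \<longrightarrow> y j \<in> U))"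

end

theory Submission
  imports Defs
begin

text \<open>
  It suffices that the minimal upper bound \<open>\<mu>\<close> is a least upper bound, since the family is then a
  directed set with supremum \<open>\<mu>\<close>. For this, two valuations \<open>\<mu>\<close>, \<open>\<mu>'\<close> of \<open>\<T>\<close> are shown to have an
  infimum; it bounds the family from above and lies below \<open>\<mu>\<close>, so by minimality it is \<open>\<mu>\<close>.

  Let \<open>\<phi>\<close> have least degree among the polynomials on which \<open>\<mu>\<close> and \<open>\<mu>'\<close> differ, say
  \<open>\<gamma> = \<mu>' \<phi> < \<mu> \<phi>\<close>. The infimum is the truncation \<open>\<Sum> a\<^sub>s \<phi>\<^sup>s \<mapsto> min\<^sub>s (\<mu> a\<^sub>s + s \<gamma>)\<close>. It is
  supermultiplicative because reducing a product modulo \<open>\<phi>\<close> does not lower its value, and it is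
  multiplicative because it coincides with \<open>\<mu>\<close> on every polynomial whose constant term \<open>a\<^sub>0\<close>
  attains the minimum.
\<close>

section \<open>Order and addition of values including infinity\<close>

instance with_inf :: (linordered_ab_group_add) ordered_ab_semigroup_add
proof
  fix a b c :: "'a with_inf"
  assume "a \<le> b"
  then show "c + a \<le> c + b" by (cases a; cases b; cases c) auto
qed

lemma Infty_le_iff [simp]: "Infty \<le> x \<longleftrightarrow> (x :: 'g::linorder with_inf) = Infty"
  by (cases x) auto

lemma less_Infty_iff [simp]: "x < Infty \<longleftrightarrow> (x :: 'g::linorder with_inf) \<noteq> Infty"
  by (simp add: less_le)

lemma not_Infty_less [simp]: "\<not> Infty < (x :: 'g::linorder with_inf)"
  by (simp add: not_less)

lemma plus_Infty_right [simp]: "x + Infty = (Infty :: 'g::comm_monoid_add with_inf)"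
  by (cases x) auto

lemma add_strict_left_mono_with_inf:
  fixes a b c :: "'g::linordered_ab_group_add with_inf"
  assumes "a < b" "c \<noteq> Infty"
  shows "c + a < c + b"
  using assms by (cases a; cases b; cases c) (auto simp: less_with_inf_def)

section \<open>Elementary properties of valuations\<close>

context
  fixes \<mu> :: "'r::comm_ring_1 \<Rightarrow> 'g::linordered_ab_group_add with_inf"
  assumes val: "valuation \<mu>"
begin

lemma valuation_mult: "\<mu> (f * g) = \<mu> f + \<mu> g"
  and valuation_add: "min (\<mu> f) (\<mu> g) \<le> \<mu> (f + g)"
  and valuation_one: "\<mu> 1 = 0"
  and valuation_zero: "\<mu> 0 = Infty"
  using val by (auto simp: valuation_def infinity_with_inf_def)

lemma valuation_uminus: "\<mu> (- f) = \<mu> f"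
proof -
  have "\<mu> (-1) + \<mu> (-1) = 0"
    using valuation_mult[of "-1" "-1"] valuation_one by simp
  then have "\<mu> (-1) = 0"
    by (cases "\<mu> (-1)") (auto simp: zero_with_inf_def)
  then show ?thesis
    using valuation_mult[of "-1" f] by simp
qed

lemma valuation_add_eq:
  assumes "\<mu> f < \<mu> g"
  shows "\<mu> (f + g) = \<mu> f"
  using valuation_add[of f g] valuation_add[of "f + g" "- g"] valuation_uminus[of g] assms
  by (auto simp: min_def split: if_splits)

end

text \<open>If the value of \<open>a\<close> were smaller than that of \<open>p + a\<close>, then \<open>p\<close> would have the value of \<open>a\<close>
  under both valuations.\<close>

lemma valuation_le_summand:
  assumes "valuation \<nu>" "valuation \<mu>"
    and "\<nu> (p + a) \<le> \<mu> (p + a)" "\<nu> a = \<mu> a" "\<nu> p < \<mu> p \<or> \<nu> p = Infty"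
  shows "\<nu> (p + a) \<le> \<nu> a"
proof (rule ccontr)
  assume "\<not> \<nu> (p + a) \<le> \<nu> a"
  then have lt: "\<nu> a < \<nu> (p + a)" "\<mu> a < \<mu> (p + a)"
    using assms by auto
  have "\<nu> p = \<nu> a" "\<mu> p = \<mu> a"
    using valuation_add_eq[of \<nu> "- a" "p + a"] valuation_add_eq[of \<mu> "- a" "p + a"]
      valuation_uminus[of \<nu> a] valuation_uminus[of \<mu> a] assms(1,2) lt
    by (simp_all add: add.commute[of p])
  with assms lt show False
    by auto
qed

section \<open>Division with remainder and key polynomials\<close>

lemma degree_mod_less_pos:
  fixes f \<phi> :: "'k::field poly"
  assumes "degree \<phi> > 0"
  shows "degree (f mod \<phi>) < degree \<phi>"
  using assms degree_mod_less[of \<phi> f] by (cases "\<phi> = 0") auto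

text \<open>The hypotheses on \<open>\<mu>\<close> make \<open>\<phi>\<close> a key polynomial of \<open>\<nu>\<close>, so that \<open>\<nu>\<close> is determined by its
  values on \<open>\<phi>\<close> and in smaller degrees.\<close>

lemma valuation_le_of_key:
  fixes \<phi> :: "'k::field poly"
  assumes val: "valuation \<nu>" "valuation \<mu>" "valuation \<rho>"
    and le: "\<nu> \<le> \<mu>" and small: "\<And>a. degree a < degree \<phi> \<Longrightarrow> \<nu> a = \<mu> a"
    and \<phi>: "\<nu> \<phi> < \<mu> \<phi>" "degree \<phi> > 0"
    and \<rho>: "\<And>a. degree a < degree \<phi> \<Longrightarrow> \<nu> a \<le> \<rho> a" "\<nu> \<phi> \<le> \<rho> \<phi>"
  shows "\<nu> f \<le> \<rho> f"
proof (induction "degree f" arbitrary: f rule: less_induct)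
  case less
  show ?case
  proof (cases "degree f < degree \<phi>")
    case False
    define q a where "q = f div \<phi>" and "a = f mod \<phi>"
    have f: "f = q * \<phi> + a" and a: "degree a < degree \<phi>"
      using degree_mod_less_pos[OF \<phi>(2)] by (auto simp: q_def a_def)
    have "degree q < degree f"
      using False \<phi>(2) degree_div_less[of f \<phi>] by (auto simp: q_def)
    then have q: "\<nu> q \<le> \<rho> q"
      by (rule less)
    have "\<nu> (q * \<phi>) < \<mu> (q * \<phi>) \<or> \<nu> (q * \<phi>) = Infty"
    proof (cases "\<nu> q = Infty")
      case False
      have "\<nu> q + \<nu> \<phi> < \<nu> q + \<mu> \<phi>"
        using \<phi>(1) False by (rule add_strict_left_mono_with_inf)
      also have "\<dots> \<le> \<mu> q + \<mu> \<phi>"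
        using le by (intro add_right_mono) (simp add: le_fun_def)
      finally show ?thesis
        by (simp add: valuation_mult val)
    qed (simp add: valuation_mult val)
    \<comment> \<open>Hence \<open>\<nu> f\<close> is at most the value of either term, so the two
      terms can be compared with \<open>\<rho>\<close> one by one.\<close>
    then have fa: "\<nu> f \<le> \<nu> a"
      unfolding f using valuation_le_summand val le small[OF a] by (metis le_funD)
    have "\<nu> f \<le> \<nu> (q * \<phi>)"
      using valuation_add[OF val(1), of f "- a"] valuation_uminus[OF val(1), of a] fa
      by (simp add: f min_def split: if_splits)
    also have "\<dots> \<le> \<rho> (q * \<phi>)"
      using q \<rho>(2) by (simp add: valuation_mult val add_mono)
    finally show ?thesis
      using fa \<rho>(1)[OF a] valuation_add[OF val(3), of "q * \<phi>" a]
      by (auto simp: f min_def split: if_splits)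
  qed (rule \<rho>)
qed

section \<open>The truncation and \<phi>-adic expansions\<close>

text \<open>Horner form of the minimum over the \<phi>-adic expansion, which avoids naming the
  coefficients. The clause \<open>degree \<phi> = 0\<close> secures termination.\<close>

function truncation ::
    "('k::field poly \<Rightarrow> 'g::linordered_ab_group_add with_inf) \<Rightarrow> 'k poly \<Rightarrow> 'g with_inf \<Rightarrow>
     'k poly \<Rightarrow> 'g with_inf" where
  "truncation \<mu> \<phi> \<gamma> f =
     (if degree f < degree \<phi> \<or> degree \<phi> = 0 then \<mu> f
      else min (\<mu> (f mod \<phi>)) (truncation \<mu> \<phi> \<gamma> (f div \<phi>) + \<gamma>))"
  by auto
termination
  by (relation "measure (\<lambda>(_, _, _, f). degree f)") (auto intro!: degree_div_less)

declare truncation.simps [simp del]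

text \<open>\<open>\<mu>\<close> supplies the values of the coefficients and \<open>\<nu>\<close>
  the value of \<open>\<phi>\<close>; in higher degree the two may be incomparable.\<close>

locale branching =
  fixes \<mu> \<nu> :: "'k::field poly \<Rightarrow> 'g::linordered_ab_group_add with_inf" and \<phi> :: "'k poly"
  assumes val: "valuation \<mu>" "valuation \<nu>"
    and agree: "\<And>a. degree a < degree \<phi> \<Longrightarrow> \<nu> a = \<mu> a"
    and branch: "\<nu> \<phi> < \<mu> \<phi>" and deg: "degree \<phi> > 0"
begin

abbreviation "\<gamma> \<equiv> \<nu> \<phi>"
abbreviation "\<tau> \<equiv> truncation \<mu> \<phi> \<gamma>"

lemma trunc_small: "degree a < degree \<phi> \<Longrightarrow> \<tau> a = \<mu> a"
  by (simp add: truncation.simps)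

lemma trunc_zero: "\<tau> 0 = Infty"
  using deg by (simp add: trunc_small valuation_zero val)

lemma degree_mult_add:
  assumes "q \<noteq> 0" "degree a < degree \<phi>"
  shows "degree (q * \<phi> + a) = degree q + degree \<phi>"
proof -
  have "degree (q * \<phi>) = degree q + degree \<phi>"
    using assms by (intro degree_mult_eq) auto
  with assms show ?thesis
    by (simp add: degree_add_eq_left)
qed

lemma trunc_mult_add:
  assumes "degree a < degree \<phi>"
  shows "\<tau> (q * \<phi> + a) = min (\<mu> a) (\<tau> q + \<gamma>)"
proof (cases "q = 0")
  case True
  then show ?thesis
    using assms by (simp add: trunc_zero trunc_small)
next
  case False
  have "degree (q * \<phi> + a) = degree q + degree \<phi>"
    using False assms by (rule degree_mult_add)
  moreover have "(q * \<phi> + a) div \<phi> = q" "(q * \<phi> + a) mod \<phi> = a"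
    using assms deg by (cases "\<phi> = 0"; simp add: div_poly_less mod_poly_less)+
  ultimately show ?thesis
    by (subst truncation.simps) (use deg in auto)
qed

lemma trunc_mult_phi: "\<tau> (q * \<phi>) = \<tau> q + \<gamma>"
  using trunc_mult_add[of 0 q] deg by (simp add: valuation_zero val)

text \<open>A constant leaves no smaller degree to descend to, hence the separate clause
  \<open>q = 0\<close>.\<close>

lemma div_mod_cases:
  obtains q a where "f = q * \<phi> + a" "degree a < degree \<phi>"
    "degree f > 0 \<longrightarrow> degree q < degree f" "degree f = 0 \<longrightarrow> q = 0"
  using that[of "f div \<phi>" "f mod \<phi>"] deg
  by (simp add: degree_mod_less_pos degree_div_less div_poly_less)

text \<open>Induction along the Horner scheme of \<open>truncation\<close>.\<close>

lemma phi_induct [case_names zero step]: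
  assumes "P 0" "\<And>q a. P q \<Longrightarrow> degree a < degree \<phi> \<Longrightarrow> P (q * \<phi> + a)"
  shows "P f"
proof (induction "degree f" arbitrary: f rule: less_induct)
  case less
  obtain q a where f: "f = q * \<phi> + a" "degree a < degree \<phi>"
    and "degree f > 0 \<longrightarrow> degree q < degree f" "degree f = 0 \<longrightarrow> q = 0"
    by (rule div_mod_cases)
  then have "P q"
    using less assms(1) by (cases "degree f = 0") auto
  then show ?case
    using f assms(2) by simp
qed

text \<open>Expansions add without carry, since \<open>a + b\<close> stays below the degree of
  \<open>\<phi>\<close>.\<close>

lemma trunc_add: "min (\<tau> f) (\<tau> g) \<le> \<tau> (f + g)"
proof (induction f arbitrary: g rule: phi_induct)
  case zero
  then show ?case by (simp add: trunc_zero)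
next
  case (step q a)
  obtain p b where g: "g = p * \<phi> + b" and b: "degree b < degree \<phi>"
    by (rule div_mod_cases)
  have eq: "q * \<phi> + a + g = (q + p) * \<phi> + (a + b)"
    by (simp add: g algebra_simps)
  have "degree (a + b) < degree \<phi>"
    using step b by (intro degree_add_less)
  then have "\<tau> (q * \<phi> + a + g) = min (\<mu> (a + b)) (\<tau> (q + p) + \<gamma>)"
    unfolding eq by (rule trunc_mult_add)
  moreover have "min (\<mu> a) (\<mu> b) \<le> \<mu> (a + b)"
    by (rule valuation_add[OF val(1)])
  moreover have "min (\<tau> q + \<gamma>) (\<tau> p + \<gamma>) \<le> \<tau> (q + p) + \<gamma>"
    using add_right_mono[OF step(1)[of p], of \<gamma>]
    by (auto simp: min_def split: if_splits dest: add_right_mono)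
  ultimately show ?case
    unfolding g using step b by (auto simp: trunc_mult_add min_le_iff_disj)
qed

text \<open>By the ultrametric inequality a valuation is at least the minimum over the terms of the
  expansion. Both \<open>\<mu>\<close> and \<open>\<nu>\<close> serve as
  \<open>\<rho>\<close>.\<close>

lemma trunc_le:
  assumes "valuation \<rho>" "\<And>a. degree a < degree \<phi> \<Longrightarrow> \<mu> a = \<rho> a" "\<gamma> \<le> \<rho> \<phi>"
  shows "\<tau> f \<le> \<rho> f"
proof (induction f rule: phi_induct)
  case zero
  then show ?case by (simp add: valuation_zero assms)
next
  case (step q a)
  have "\<tau> (q * \<phi> + a) \<le> min (\<rho> a) (\<rho> q + \<rho> \<phi>)"
    using step assms(2)[of a] add_mono[OF step(1) assms(3)]
    by (auto simp: trunc_mult_add min_le_iff_disj)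
  also have "\<dots> \<le> \<rho> (q * \<phi> + a)"
    using valuation_add[OF assms(1), of a "q * \<phi>"] valuation_mult[OF assms(1)]
    by (simp add: add.commute)
  finally show ?case .
qed

lemma trunc_le_upper: "\<tau> f \<le> \<mu> f"
  using trunc_le[of \<mu>] val branch by simp

lemma trunc_le_lower: "\<tau> f \<le> \<nu> f"
  using trunc_le[of \<nu>] val agree by simp

section \<open>Supermultiplicativity of the truncation\<close>

text \<open>A remainder of smaller value than the product would have to be cancelled by
  \<open>q * \<phi>\<close> under both valuations. But \<open>\<nu>\<close> gives that term a
  strictly smaller value than \<open>\<mu>\<close> does, or the value infinity.\<close>

lemma trunc_mult_small:
  assumes "degree a < degree \<phi>" "degree b < degree \<phi>"
  shows "\<mu> a + \<mu> b \<le> \<tau> (a * b)"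
proof -
  define q r where "q = a * b div \<phi>" and "r = a * b mod \<phi>"
  have ab: "a * b = q * \<phi> + r" and r: "degree r < degree \<phi>"
    using degree_mod_less_pos[OF deg] by (auto simp: q_def r_def)
  \<comment> \<open>The product has degree below \<open>2 * degree \<phi>\<close>, so
    \<open>r\<close> and \<open>q\<close> are its only coefficients.\<close>
  have q: "degree q < degree \<phi>"
  proof (cases "q = 0")
    case False
    then have "degree (q * \<phi> + r) = degree q + degree \<phi>"
      using r by (rule degree_mult_add)
    then show ?thesis
      using assms degree_mult_le[of a b] by (simp add: ab)
  qed (simp add: deg)
  have eq: "\<nu> (q * \<phi> + r) = \<mu> a + \<mu> b" "\<mu> (q * \<phi> + r) = \<mu> a + \<mu> b"
    by (simp_all add: ab[symmetric] valuation_mult val agree assms)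
  have "\<nu> (q * \<phi>) < \<mu> (q * \<phi>) \<or> \<nu> (q * \<phi>) = Infty"
    using branch by (auto simp: valuation_mult val agree[OF q] intro: add_strict_left_mono_with_inf)
  then have *: "\<mu> a + \<mu> b \<le> \<mu> r"
    using valuation_le_summand[OF val(2,1), of "q * \<phi>" r] eq agree[OF r] by simp
  moreover have "\<mu> a + \<mu> b \<le> \<mu> q + \<gamma>"
    using valuation_add[OF val(2), of "q * \<phi> + r" "- r"] * eq
    by (simp add: valuation_uminus valuation_mult val agree q r)
  ultimately show ?thesis
    unfolding ab by (simp add: trunc_mult_add[OF r] trunc_small[OF q])
qed

lemma trunc_add_ge: "c \<le> \<tau> f \<Longrightarrow> c \<le> \<tau> g \<Longrightarrow> c \<le> \<tau> (f + g)"
  using trunc_add[of f g] by (metis min.boundedI order.trans)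

text \<open>The coefficients of \<open>g\<close> are multiplied by \<open>a\<close> one at a time;
  \<open>trunc_add_ge\<close> absorbs the carries.\<close>

lemma trunc_mult_ge_small:
  assumes "degree a < degree \<phi>"
  shows "\<mu> a + \<tau> g \<le> \<tau> (a * g)"
proof (induction g rule: phi_induct)
  case zero
  then show ?case by (simp add: trunc_zero)
next
  case (step q b)
  have g: "\<tau> (q * \<phi> + b) \<le> \<mu> b" "\<tau> (q * \<phi> + b) \<le> \<tau> q + \<gamma>"
    using step by (auto simp: trunc_mult_add)
  have "\<mu> a + \<tau> (q * \<phi> + b) \<le> \<tau> (a * b)"
    using add_left_mono[OF g(1)] trunc_mult_small[OF assms step(2)] by (rule order.trans)
  moreover have "\<mu> a + \<tau> (q * \<phi> + b) \<le> \<tau> (a * q * \<phi>)"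
    using add_left_mono[OF g(2), of "\<mu> a"] add_right_mono[OF step(1), of \<gamma>]
    by (simp only: trunc_mult_phi) (simp add: add.assoc)
  ultimately have "\<mu> a + \<tau> (q * \<phi> + b) \<le> \<tau> (a * q * \<phi> + a * b)"
    by (intro trunc_add_ge)
  then show ?case
    by (simp add: algebra_simps)
qed

lemma trunc_mult_ge: "\<tau> f + \<tau> g \<le> \<tau> (f * g)"
proof (induction f rule: phi_induct)
  case zero
  then show ?case by (simp add: trunc_zero)
next
  case (step q a)
  have f: "\<tau> (q * \<phi> + a) \<le> \<mu> a" "\<tau> (q * \<phi> + a) \<le> \<tau> q + \<gamma>"
    using step by (auto simp: trunc_mult_add)
  have "\<tau> (q * \<phi> + a) + \<tau> g \<le> \<tau> (a * g)"
    using add_right_mono[OF f(1)] trunc_mult_ge_small[OF step(2)] by (rule order.trans)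
  moreover have "\<tau> (q * \<phi> + a) + \<tau> g \<le> \<tau> (q * g * \<phi>)"
    using add_right_mono[OF f(2), of "\<tau> g"] add_right_mono[OF step(1), of \<gamma>]
    by (simp only: trunc_mult_phi) (simp add: ac_simps)
  ultimately have "\<tau> (q * \<phi> + a) + \<tau> g \<le> \<tau> (q * g * \<phi> + a * g)"
    by (intro trunc_add_ge)
  then show ?case
    by (simp add: algebra_simps)
qed

section \<open>Multiplicativity of the truncation\<close>

text \<open>As \<open>\<tau>\<close> is not yet known to be a valuation, supermultiplicativity with
  the factor \<open>- 1\<close>, used in both directions, takes the place of
  \<open>valuation_uminus\<close>.\<close>

lemma trunc_uminus: "\<tau> (- f) = \<tau> f"
proof -
  have le: "\<tau> g \<le> \<tau> (- g)" for g
    using trunc_mult_ge_small[of "- 1" g] deg by (simp add: valuation_uminus valuation_one val)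
  show ?thesis
    using le[of f] le[of "- f"] by simp
qed

lemma trunc_add_eq:
  assumes "\<tau> f < \<tau> g"
  shows "\<tau> (f + g) = \<tau> f"
  using trunc_add[of f g] trunc_add[of "f + g" "- g"] trunc_uminus[of g] assms
  by (auto simp: min_def split: if_splits)

text \<open>Since \<open>\<mu> \<phi>\<close> exceeds \<open>\<gamma>\<close>, a finite constant
  term that attains the minimum for \<open>\<tau>\<close> is strictly dominant for
  \<open>\<mu>\<close>.\<close>

lemma trunc_eq_upper:
  assumes "degree a < degree \<phi>" "\<mu> a \<le> \<tau> q + \<gamma>"
  shows "\<tau> (q * \<phi> + a) = \<mu> (q * \<phi> + a)"
proof (cases "\<mu> a = Infty")
  case True
  then have "\<tau> (q * \<phi> + a) = Infty"
    using assms by (simp add: trunc_mult_add)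
  then show ?thesis
    using trunc_le_upper[of "q * \<phi> + a"] by simp
next
  case False
  have "\<mu> a < \<mu> (q * \<phi>)"
  proof (cases "\<tau> q = Infty")
    case True
    then show ?thesis
      using False trunc_le_upper[of q] by (simp add: valuation_mult val)
  next
    case False
    have "\<mu> a \<le> \<tau> q + \<gamma>" by fact
    also have "\<dots> < \<tau> q + \<mu> \<phi>"
      using branch False by (rule add_strict_left_mono_with_inf)
    also have "\<dots> \<le> \<mu> q + \<mu> \<phi>"
      by (intro add_right_mono trunc_le_upper)
    finally show ?thesis
      by (simp add: valuation_mult val)
  qed
  then show ?thesis
    using valuation_add_eq[OF val(1), of a "q * \<phi>"] assms
    by (simp add: add.commute[of a] trunc_mult_add)
qed

text \<open>When the constant term does not attain the minimum, it may be dropped.\<close>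

lemma trunc_mult_step:
  assumes a: "degree a < degree \<phi>" and lt: "\<tau> q + \<gamma> < \<mu> a"
    and mult: "\<tau> (q * g) = \<tau> q + \<tau> g"
  shows "\<tau> ((q * \<phi> + a) * g) = \<tau> (q * \<phi> + a) + \<tau> g"
proof -
  have f: "\<tau> (q * \<phi> + a) = \<tau> q + \<gamma>"
    using a lt by (simp add: trunc_mult_add)
  show ?thesis
  proof (cases "\<tau> g = Infty")
    case True
    then show ?thesis
      using trunc_mult_ge[of "q * \<phi> + a" g] by simp
  next
    case False
    have "\<tau> (q * g * \<phi>) = \<tau> q + \<tau> g + \<gamma>"
      by (simp only: trunc_mult_phi mult)
    then have eq: "\<tau> (q * g * \<phi>) = \<tau> g + (\<tau> q + \<gamma>)"
      by (simp add: ac_simps)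
    also have "\<dots> < \<tau> g + \<mu> a"
      using lt False by (rule add_strict_left_mono_with_inf)
    also have "\<dots> \<le> \<tau> (a * g)"
      using trunc_mult_ge_small[OF a] by (simp add: add.commute)
    finally have "\<tau> (q * g * \<phi> + a * g) = \<tau> g + (\<tau> q + \<gamma>)"
      using trunc_add_eq eq by simp
    moreover have "(q * \<phi> + a) * g = q * g * \<phi> + a * g"
      by (simp add: algebra_simps)
    ultimately show ?thesis
      by (simp add: f add.commute[of "\<tau> g"])
  qed
qed

text \<open>If the constant term of \<open>g\<close> attains the minimum,
  \<open>\<tau> (f * g)\<close> is squeezed between supermultiplicativity and
  \<open>\<mu> (f * g)\<close>. Otherwise that term is dropped and the induction hypothesis
  applies.\<close>

lemma trunc_mult_of_eq:
  assumes "\<tau> f = \<mu> f"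
  shows "\<tau> (f * g) = \<tau> f + \<tau> g"
proof (induction g rule: phi_induct)
  case zero
  then show ?case by (simp add: trunc_zero)
next
  case (step q b)
  show ?case
  proof (cases "\<mu> b \<le> \<tau> q + \<gamma>")
    case True
    then show ?thesis
      using trunc_mult_ge[of f "q * \<phi> + b"] trunc_le_upper[of "f * (q * \<phi> + b)"]
      by (intro antisym) (simp_all add: assms trunc_eq_upper step valuation_mult val)
  next
    case False
    then show ?thesis
      using trunc_mult_step[of b q f] step by (simp add: ac_simps)
  qed
qed

lemma trunc_mult: "\<tau> (f * g) = \<tau> f + \<tau> g"
proof (induction f rule: phi_induct)
  case zero
  then show ?case by (simp add: trunc_zero)
next
  case (step q a)
  then show ?case
    using trunc_mult_of_eq trunc_eq_upper trunc_mult_step by (cases "\<mu> a \<le> \<tau> q + \<gamma>") auto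
qed

lemma valuation_trunc: "valuation \<tau>"
  using deg valuation_one[OF val(1)]
  by (simp add: valuation_def trunc_mult trunc_add trunc_zero infinity_with_inf_def trunc_small)

section \<open>The truncation as infimum\<close>

text \<open>A polynomial \<open>\<psi>\<close> of least degree on which \<open>\<rho>\<close> and
  \<open>\<mu>\<close> differ is key for \<open>\<rho>\<close>, so
  \<open>valuation_le_of_key\<close> reduces the claim to \<open>\<psi>\<close> and smaller
  degrees.\<close>

lemma trunc_greatest:
  assumes \<rho>: "valuation \<rho>" "\<rho> \<le> \<mu>" "\<rho> \<le> \<nu>" "\<And>c. \<rho> [:c:] = \<mu> [:c:]"
  shows "\<rho> \<le> \<tau>"
proof -
  let ?P = "\<lambda>\<psi>. \<rho> \<psi> \<noteq> \<mu> \<psi>"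
  have P\<phi>: "?P \<phi>"
    using branch \<rho>(3) by (metis le_funD leD)
  \<comment> \<open>If \<open>\<phi>\<close> already has the least degree, \<open>\<psi>\<close> is
    chosen to be \<open>\<phi>\<close> itself, where \<open>\<tau>\<close> takes the value
    \<open>\<gamma>\<close>; in smaller degree \<open>\<tau>\<close> is
    \<open>\<mu>\<close>.\<close>
  obtain \<psi> where \<psi>: "?P \<psi>" "\<And>a. degree a < degree \<psi> \<Longrightarrow> \<rho> a = \<mu> a"
    "degree \<psi> < degree \<phi> \<or> \<psi> = \<phi>"
  proof (cases "\<forall>a. degree a < degree \<phi> \<longrightarrow> \<rho> a = \<mu> a")
    case True
    with P\<phi> that show ?thesis by blast
  next
    case False
    then obtain b where b: "degree b < degree \<phi>" "?P b" by blast
    let ?\<psi> = "arg_min degree ?P"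
    have "?P ?\<psi>" "degree ?\<psi> \<le> degree a" if "?P a" for a
      using arg_min_natI[of ?P a degree] arg_min_nat_le[of ?P a degree] that by auto
    with b that[of ?\<psi>] show ?thesis
      by (meson le_less_trans not_le)
  qed
  have "degree \<psi> > 0"
    using \<psi>(1) \<rho>(4) by (metis degree_eq_zeroE neq0_conv)
  moreover have "\<rho> \<psi> < \<mu> \<psi>"
    using \<psi>(1) \<rho>(2) by (simp add: le_fun_def less_le)
  moreover have "\<rho> a \<le> \<tau> a" if "degree a < degree \<psi>" for a
    using that \<psi> trunc_small[of a] by auto
  moreover have "\<tau> \<phi> = \<gamma>"
    using trunc_mult_phi[of 1] trunc_small[of 1] deg
    by (simp add: valuation_one val)
  then have "\<rho> \<psi> \<le> \<tau> \<psi>"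
    using \<psi>(3) \<rho>(2,3) trunc_small[of \<psi>] by (auto simp: le_fun_def)
  ultimately have "\<rho> f \<le> \<tau> f" for f
    using valuation_le_of_key[OF \<rho>(1) val(1) valuation_trunc \<rho>(2) \<psi>(2)] by blast
  then show ?thesis
    by (simp add: le_fun_def)
qed

end

theorem valuations_over_infimum:
  fixes v :: "'k::field \<Rightarrow> 'g::linordered_ab_group_add with_inf"
  assumes "\<mu> \<in> valuations_over v" "\<mu>' \<in> valuations_over v"
  shows "\<exists>\<rho>\<in>valuations_over v. \<rho> \<le> \<mu> \<and> \<rho> \<le> \<mu>' \<and>
           (\<forall>\<nu>\<in>valuations_over v. \<nu> \<le> \<mu> \<and> \<nu> \<le> \<mu>' \<longrightarrow> \<nu> \<le> \<rho>)"
proof (cases "\<mu> = \<mu>'")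
  case False
  then obtain f where f: "\<mu> f \<noteq> \<mu>' f" by blast
  define \<phi> where "\<phi> = arg_min degree (\<lambda>f. \<mu> f \<noteq> \<mu>' f)"
  have \<phi>: "\<mu> \<phi> \<noteq> \<mu>' \<phi>"
    unfolding \<phi>_def by (rule arg_min_natI) (rule f)
  have agree: "\<mu> a = \<mu>' a" if "degree a < degree \<phi>" for a
    using arg_min_nat_le[of "\<lambda>f. \<mu> f \<noteq> \<mu>' f" a degree] that unfolding \<phi>_def by auto
  have deg: "degree \<phi> > 0"
    using \<phi> assms by (metis (mono_tags, lifting) degree_eq_zeroE mem_Collect_eq neq0_conv valuations_over_def)
  \<comment> \<open>The unordered pair lets one argument serve whichever valuation is smaller at
    \<open>\<phi>\<close>.\<close>
  have *: ?thesis if "\<alpha> \<phi> < \<beta> \<phi>" "{\<alpha>, \<beta>} = {\<mu>, \<mu>'}" for \<alpha> \<beta>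
  proof -
    have in_T: "\<alpha> \<in> valuations_over v" "\<beta> \<in> valuations_over v"
      using that assms by (auto simp: doubleton_eq_iff)
    interpret branching \<beta> \<alpha> \<phi>
      using that in_T agree deg by unfold_locales (auto simp: doubleton_eq_iff valuations_over_def)
    have "truncation \<beta> \<phi> (\<alpha> \<phi>) \<in> valuations_over v"
      using in_T deg by (auto simp: valuations_over_def valuation_trunc trunc_small)
    moreover have "\<nu> \<le> truncation \<beta> \<phi> (\<alpha> \<phi>)" if "\<nu> \<in> valuations_over v" "\<nu> \<le> \<beta>" "\<nu> \<le> \<alpha>" for \<nu>
      using that in_T by (intro trunc_greatest) (auto simp: valuations_over_def)
    moreover have "truncation \<beta> \<phi> (\<alpha> \<phi>) \<le> \<beta>" "truncation \<beta> \<phi> (\<alpha> \<phi>) \<le> \<alpha>"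
      by (simp_all add: le_fun_def trunc_le_upper trunc_le_lower)
    ultimately show ?thesis
      using that(2) by (auto simp: doubleton_eq_iff)
  qed
  show ?thesis
    using \<phi> *[of \<mu> \<mu>'] *[of \<mu>' \<mu>] by (auto simp: neq_iff)
qed (use assms in auto)

section \<open>Suprema of families and Scott convergence\<close>

lemma is_family_sup_imp_is_lub_in:
  assumes "increasing_family v I \<nu>" "is_family_sup v I \<nu> \<mu>"
  shows "is_lub_in (valuations_over v) (\<nu> ` I) \<mu>"
proof -
  have \<mu>: "\<mu> \<in> valuations_over v" "\<And>i. i \<in> I \<Longrightarrow> \<nu> i \<le> \<mu>"
    and min: "\<And>\<rho>. \<rho> \<in> valuations_over v \<Longrightarrow> (\<And>i. i \<in> I \<Longrightarrow> \<nu> i \<le> \<rho>) \<Longrightarrow> \<rho> \<le> \<mu> \<Longrightarrow> \<rho> = \<mu>"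
    using assms(2) unfolding is_family_sup_def by blast+
  have sub: "\<nu> i \<in> valuations_over v" if "i \<in> I" for i
    using assms(1) that unfolding increasing_family_def by blast
  have "\<mu> \<le> \<mu>'" if \<mu>': "\<mu>' \<in> valuations_over v" "\<And>i. i \<in> I \<Longrightarrow> \<nu> i \<le> \<mu>'" for \<mu>'
  proof -
    obtain \<rho> where \<rho>: "\<rho> \<in> valuations_over v" "\<rho> \<le> \<mu>" "\<rho> \<le> \<mu>'"
      "\<And>\<kappa>. \<kappa> \<in> valuations_over v \<Longrightarrow> \<kappa> \<le> \<mu> \<Longrightarrow> \<kappa> \<le> \<mu>' \<Longrightarrow> \<kappa> \<le> \<rho>"
      using valuations_over_infimum[OF \<mu>(1) \<mu>'(1)] by blast
    \<comment> \<open>Each \<open>\<nu> i\<close> is a common lower bound of \<open>\<mu>\<close>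
      and \<open>\<mu>'\<close>, so the infimum \<open>\<rho>\<close> still bounds the
      family.\<close>
    then have "\<rho> = \<mu>"
      using min \<mu>(2) \<mu>'(2) sub by blast
    with \<rho>(3) show ?thesis by simp
  qed
  with \<mu> show ?thesis
    unfolding is_lub_in_def by blast
qed

theorem proposition6p13:
  fixes v :: "'k::field \<Rightarrow> 'g::linordered_ab_group_add with_inf"
    and I :: "'i::order set"
    and \<nu> :: "'i \<Rightarrow> 'k poly \<Rightarrow> 'g with_inf"
    and \<mu> :: "'k poly \<Rightarrow> 'g with_inf"
  assumes "valued_field v"
    and "\<exists>\<Gamma>\<^sub>Q. is_divisible_hull (value_group v) \<Gamma>\<^sub>Q"
    and "increasing_family v I \<nu>"
    and "is_family_sup v I \<nu> \<mu>"
  shows "is_net_limit (scott_topology (valuations_over v)) I \<nu> \<mu>"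
proof -
  have I: "I \<noteq> {}" "\<nu> ` I \<subseteq> valuations_over v" "Complete_Partial_Order.chain (\<le>) (\<nu> ` I)"
    and mono: "\<And>i j. i \<in> I \<Longrightarrow> j \<in> I \<Longrightarrow> i < j \<longleftrightarrow> \<nu> i < \<nu> j"
    using assms(3) unfolding increasing_family_def by blast+
  have lub: "is_lub_in (valuations_over v) (\<nu> ` I) \<mu>"
    using assms(3,4) by (rule is_family_sup_imp_is_lub_in)
  have dir: "directed_subset (valuations_over v) (\<nu> ` I)"
    unfolding directed_subset_def using I chainD[OF I(3)] by (metis image_is_empty order_refl)
  have "\<exists>i\<^sub>0\<in>I. \<forall>j\<in>I. i\<^sub>0 \<le> j \<longrightarrow> \<nu> j \<in> U"
    if U: "scott_open (valuations_over v) U" "\<mu> \<in> U" for U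
  proof -
    \<comment> \<open>Openness yields one member of the family in \<open>U\<close>; as
      \<open>U\<close> is an upper set, all later members follow.\<close>
    obtain i where i: "i \<in> I" "\<nu> i \<in> U"
      using U dir lub unfolding scott_open_def by blast
    have "\<nu> j \<in> U" if j: "j \<in> I" "i \<le> j" for j
    proof -
      have "\<nu> i \<le> \<nu> j"
        using mono[OF i(1) j(1)] j(2) by (auto simp: le_less)
      then show ?thesis
        using U(1) i I(2) j(1) unfolding scott_open_def by blast
    qed
    with i(1) show ?thesis by blast
  qed
  moreover have "\<mu> \<in> valuations_over v"
    using lub by (simp add: is_lub_in_def)
  ultimately show ?thesis
    using I(2) by (simp add: is_net_limit_def)
qed

end
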